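(* For each integer $a\ge 0$, there exists an integer $t_1=t_1(a)$ such that for every integer $t\ge t_1$, there exists a $K_t$-minor-free graph that is not $\{1\star (t-2a-6),\,3a+6\}$-choosable.
   Context: All graphs are finite and simple. A graph is $K_t$-minor-free if $K_t$ cannot be obtained from a subgraph of it by contracting edges. A list assignment $L$ of a graph $G$ assigns to each vertex $v$ a set $L(v)$ of colours; an $L$-colouring is a proper colouring $f$ with $f(v)\in L(v)$ for all $v$. For a multiset $\lambda=\{k_1,\dots,k_q\}$ of positive integers, a $\lambda$-list assignment of $G$ is a list assignment $L$ such that the colour set $\bigcup_{v\in V(G)}L(v)$ can be partitioned into $q$ sets $C_1,\dots,C_q$ with $|L(v)\cap C_i|\ge k_i$ for every $i$ and every vertex $v$. $G$ is $\lambda$-choosable if $G$ is $L$-colourable for every $\lambda$-list assignment $L$. The notation $b\star m$ inside a multiset means $m$ copies of $b$; so $\{1\star(t-2a-6),3a+6\}$ consists of $t-2a-6$ ones and one copy of $3a+6$. *)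

theory Defs
  imports Main
begin

definition simple_graph :: "'a set \<Rightarrow> ('a \<Rightarrow> 'a \<Rightarrow> bool) \<Rightarrow> bool" where
  "simple_graph V E \<longleftrightarrow> finite V \<and> (\<forall>u v. E u v \<longrightarrow> u \<in> V \<and> v \<in> V)
     \<and> (\<forall>u v. E u v \<longrightarrow> E v u) \<and> (\<forall>v. \<not> E v v)"

definition connected_in :: "('a \<Rightarrow> 'a \<Rightarrow> bool) \<Rightarrow> 'a set \<Rightarrow> bool" where
  "connected_in E B \<longleftrightarrow> B \<noteq> {} \<and>
     (\<forall>x\<in>B. \<forall>y\<in>B. (\<lambda>u v. u \<in> B \<and> v \<in> B \<and> E u v)\<^sup>*\<^sup>* x y)"

definition has_K_minor :: "'a set \<Rightarrow> ('a \<Rightarrow> 'a \<Rightarrow> bool) \<Rightarrow> nat \<Rightarrow> bool" where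
  "has_K_minor V E t \<longleftrightarrow> (\<exists>B :: nat \<Rightarrow> 'a set.
     (\<forall>i<t. B i \<subseteq> V \<and> connected_in E (B i)) \<and>
     (\<forall>i<t. \<forall>j<t. i \<noteq> j \<longrightarrow> B i \<inter> B j = {}) \<and>
     (\<forall>i<t. \<forall>j<t. i \<noteq> j \<longrightarrow> (\<exists>u\<in>B i. \<exists>v\<in>B j. E u v)))"

definition K_minor_free :: "'a set \<Rightarrow> ('a \<Rightarrow> 'a \<Rightarrow> bool) \<Rightarrow> nat \<Rightarrow> bool" where
  "K_minor_free V E t \<longleftrightarrow> \<not> has_K_minor V E t"

definition L_colouring :: "'a set \<Rightarrow> ('a \<Rightarrow> 'a \<Rightarrow> bool) \<Rightarrow> ('a \<Rightarrow> 'c set) \<Rightarrow> ('a \<Rightarrow> 'c) \<Rightarrow> bool" where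
  "L_colouring V E L f \<longleftrightarrow> (\<forall>v\<in>V. f v \<in> L v) \<and> (\<forall>u\<in>V. \<forall>v\<in>V. E u v \<longrightarrow> f u \<noteq> f v)"

definition L_colourable :: "'a set \<Rightarrow> ('a \<Rightarrow> 'a \<Rightarrow> bool) \<Rightarrow> ('a \<Rightarrow> 'c set) \<Rightarrow> bool" where
  "L_colourable V E L \<longleftrightarrow> (\<exists>f. L_colouring V E L f)"

text \<open>lambda-list assignment, with the multiset lambda = {k_1,...,k_q} given as a list ks
  (order irrelevant). The colour set is partitioned into parts C 0, ..., C (q-1).\<close>
definition lambda_list_assignment ::
  "'a set \<Rightarrow> nat list \<Rightarrow> ('a \<Rightarrow> 'c set) \<Rightarrow> bool" where
  "lambda_list_assignment V ks L \<longleftrightarrow> (\<exists>C :: nat \<Rightarrow> 'c set.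
     (\<Union>i<length ks. C i) = (\<Union>v\<in>V. L v) \<and>
     (\<forall>i<length ks. \<forall>j<length ks. i \<noteq> j \<longrightarrow> C i \<inter> C j = {}) \<and>
     (\<forall>i<length ks. \<forall>v\<in>V. card (L v \<inter> C i) \<ge> ks ! i))"

definition lambda_choosable :: "'a set \<Rightarrow> ('a \<Rightarrow> 'a \<Rightarrow> bool) \<Rightarrow> nat list \<Rightarrow> bool" where
  "lambda_choosable V E ks \<longleftrightarrow>
     (\<forall>L :: 'a \<Rightarrow> nat set. lambda_list_assignment V ks L \<longrightarrow> L_colourable V E L)"

end

theory Submission
  imports Defs "HOL-Library.Countable"
begin

text \<open>
  Let \<open>m = t - 2a - 6\<close> and \<open>r = 2a + 5\<close>. All lists come from \<open>m\<close> common colours and \<open>3a + 7\<close> special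
  ones. A clique \<open>A\<close> on \<open>t - 1 = m + r\<close> vertices receives the full lists, so in any colouring some
  \<open>r\<close> of its vertices \<open>x(0), \<dots>, x(r-1)\<close> have special colours \<open>c(0), \<dots>, c(r-1)\<close>. For every possible outcome
  \<open>(x, c)\<close> we attach a private clique of \<open>t - a - 3\<close> vertices, whose \<open>j\<close>-th vertex is adjacent to all
  \<open>x(i)\<close> except \<open>i = j mod r\<close>, and whose list misses \<open>c(j mod r)\<close>. For the actual outcome, the \<open>t + a + 2\<close>
  vertices of this clique and of \<open>x\<close> need distinct colours, but only \<open>m + 3a + 7 = t + a + 1\<close> exist.

  In a \<open>K\<^sub>t\<close>-minor, some branch set avoids \<open>A\<close>, hence lies in one attached clique \<open>B\<close>, so that every
  branch set meets \<open>B \<union> X\<close>, where \<open>X = {x(0), \<dots>, x(r-1)}\<close>. At least \<open>a + 3\<close> of them avoid \<open>B\<close>, and as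
  \<open>2(a + 3) > r\<close> one of these meets \<open>X\<close> in a single vertex \<open>y\<close>. All others contain another
  vertex of \<open>X\<close> or a neighbour of \<open>y\<close> in \<open>B\<close>, and for large \<open>t\<close> there are fewer than \<open>t - 1\<close> of those.
\<close>

text \<open>A path inside \<open>S\<close> that starts in \<open>B\<close> could leave
  \<open>B\<close> only through \<open>X\<close>, which \<open>S\<close> avoids.\<close>

lemma connected_in_subset_of_boundary:
  assumes conn: "connected_in E S" and meet: "S \<inter> B \<noteq> {}" and avoid: "S \<inter> X = {}"
    and nbr: "\<And>u v. u \<in> B \<Longrightarrow> E u v \<Longrightarrow> v \<in> B \<union> X"
  shows "S \<subseteq> B"
proof
  fix y assume y: "y \<in> S"
  obtain x where x: "x \<in> S" "x \<in> B" using meet by blast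
  have "(\<lambda>u v. u \<in> S \<and> v \<in> S \<and> E u v)\<^sup>*\<^sup>* x y"
    using conn x y unfolding connected_in_def by blast
  then show "y \<in> B"
    by (induction rule: rtranclp_induct) (use x nbr avoid in blast)+
qed

text \<open>Picking a point of \<open>W\<close> in each set is an injective choice, by
  disjointness.\<close>

lemma card_le_of_disjoint_hitting:
  assumes fin: "finite W"
    and disj: "\<And>i j. i \<in> I \<Longrightarrow> j \<in> I \<Longrightarrow> i \<noteq> j \<Longrightarrow> S i \<inter> S j = {}"
    and meet: "\<And>i. i \<in> I \<Longrightarrow> S i \<inter> W \<noteq> {}"
  shows "card I \<le> card W"
proof -
  have "\<forall>i\<in>I. \<exists>w. w \<in> S i \<inter> W" using meet by blast
  then obtain g where g: "\<forall>i\<in>I. g i \<in> S i \<inter> W" by (rule bchoice[THEN exE])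
  have "inj_on g I" using g disj by (fastforce simp: inj_on_def)
  moreover have "g ` I \<subseteq> W" using g by blast
  ultimately show ?thesis using fin card_inj_on_le by blast
qed

text \<open>Isolates what excludes the minor: each piece \<open>B k\<close> is attached to
  \<open>A\<close> only along \<open>X k\<close>, with \<open>card (X k) < 2 * (a + 3)\<close>, and
  \<open>deg\<close> leaves too few vertices near any single \<open>x\<close> of \<open>X k\<close>
  for \<open>t - 1\<close> further branch sets.\<close>

lemma K_minor_free_attached_pieces:
  fixes A :: "'a set" and B X :: "'k \<Rightarrow> 'a set" and a t :: nat
  assumes V: "V \<subseteq> A \<union> (\<Union>k\<in>K. B k)"
    and A: "finite A" "card A < t"
    and X: "\<And>k. k \<in> K \<Longrightarrow> X k \<subseteq> A" "\<And>k. k \<in> K \<Longrightarrow> card (X k) \<le> 2 * a + 5"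
    and B: "\<And>k. k \<in> K \<Longrightarrow> finite (B k)" "\<And>k. k \<in> K \<Longrightarrow> card (B k) + a + 3 \<le> t"
    and nbr: "\<And>k u v. k \<in> K \<Longrightarrow> u \<in> B k \<Longrightarrow> E u v \<Longrightarrow> v \<in> B k \<union> X k"
    and deg: "\<And>k x. k \<in> K \<Longrightarrow> x \<in> X k \<Longrightarrow> card {v \<in> B k. E v x} + card (X k) < t"
  shows "K_minor_free V E t"
  unfolding K_minor_free_def
proof
  assume "has_K_minor V E t"
  then obtain S :: "nat \<Rightarrow> 'a set" where
        "\<forall>i<t. S i \<subseteq> V \<and> connected_in E (S i)"
        "\<forall>i<t. \<forall>j<t. i \<noteq> j \<longrightarrow> S i \<inter> S j = {}"
        "\<forall>i<t. \<forall>j<t. i \<noteq> j \<longrightarrow> (\<exists>u\<in>S i. \<exists>v\<in>S j. E u v)"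
    unfolding has_K_minor_def by blast
  then have S: "\<And>i. i < t \<Longrightarrow> S i \<subseteq> V" "\<And>i. i < t \<Longrightarrow> connected_in E (S i)"
    and disj: "\<And>i j. i < t \<Longrightarrow> j < t \<Longrightarrow> i \<noteq> j \<Longrightarrow> S i \<inter> S j = {}"
    and adj: "\<And>i j. i < t \<Longrightarrow> j < t \<Longrightarrow> i \<noteq> j \<Longrightarrow> \<exists>u\<in>S i. \<exists>v\<in>S j. E u v"
    by blast+
  have "\<exists>i<t. S i \<inter> A = {}"
  proof (rule ccontr)
    assume "\<not> ?thesis"
    then have "card {..<t} \<le> card A"
      using A disj by (intro card_le_of_disjoint_hitting[where S = S]) auto
    then show False using A by simp
  qed
  then obtain l where l: "l < t" "S l \<inter> A = {}" by blast
  have "S l \<noteq> {}" using S(2)[OF l(1)] by (simp add: connected_in_def)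
  then obtain k where k: "k \<in> K" "S l \<inter> B k \<noteq> {}" using S(1)[OF l(1)] l V by blast
  have in_piece: "S i \<subseteq> B k" if "i < t" "S i \<inter> B k \<noteq> {}" "S i \<inter> X k = {}" for i
    by (rule connected_in_subset_of_boundary[OF S(2)[OF that(1)] that(2,3)])
      (rule nbr[OF k(1)])
  have "S l \<inter> X k = {}" using l X(1)[OF k(1)] by blast
  then have l_sub: "S l \<subseteq> B k" using in_piece l k by blast
  \<comment> \<open>A branch set other than \<open>S l\<close> contains a neighbour of a vertex of
    \<open>S l\<close>, and \<open>S l\<close> lies in \<open>B k\<close>.\<close>
  have meet: "S i \<inter> (B k \<union> X k) \<noteq> {}" if "i < t" for i
  proof (cases "i = l")
    case False
    then show ?thesis using adj[OF l(1) that] l_sub nbr[OF k(1)] by fastforce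
  qed (use k in blast)
  have finX: "finite (X k)" using X(1)[OF k(1)] A finite_subset by blast
  define I where "I = {i. i < t \<and> S i \<inter> B k = {}}"
  \<comment> \<open>The branch sets that do meet \<open>B k\<close> are disjoint, so there are at
    most \<open>card (B k)\<close> of them.\<close>
  have "card ({..<t} - I) \<le> card (B k)"
    using B(1)[OF k(1)] disj by (intro card_le_of_disjoint_hitting[where S = S]) (auto simp: I_def)
  moreover have "card ({..<t} - I) = t - card I"
    by (subst card_Diff_subset) (auto simp: I_def)
  ultimately have cardI: "a + 3 \<le> card I" using B(2)[OF k(1)] by linarith
  have "\<exists>i\<in>I. card (S i \<inter> X k) < 2"
  proof (rule ccontr)
    assume "\<not> ?thesis"
    then have "2 \<le> card (S i \<inter> X k)" if "i \<in> I" for i using that by force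
    then have "2 * card I \<le> (\<Sum>i\<in>I. card (S i \<inter> X k))"
      using sum_mono[of I "\<lambda>_. 2" "\<lambda>i. card (S i \<inter> X k)"] by simp
    also have "\<dots> = card (\<Union>i\<in>I. S i \<inter> X k)"
    proof (rule card_UN_disjoint[symmetric])
      show "\<forall>i\<in>I. \<forall>j\<in>I. i \<noteq> j \<longrightarrow> S i \<inter> X k \<inter> (S j \<inter> X k) = {}"
        using disj by (fastforce simp: I_def)
    qed (use finX in \<open>auto simp: I_def\<close>)
    also have "\<dots> \<le> card (X k)" by (rule card_mono) (use finX in auto)
    finally show False using cardI X(2)[OF k(1)] by linarith
  qed
  then obtain i where i: "i \<in> I" "card (S i \<inter> X k) < 2" by blast
  then have it: "i < t" and iB: "S i \<inter> B k = {}" by (auto simp: I_def)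
  have "S i \<inter> X k \<noteq> {}" using meet[OF it] iB by blast
  then have "card (S i \<inter> X k) = 1" using i finX by (simp add: less_2_cases_iff)
  then obtain x where x: "S i \<inter> X k = {x}" by (rule card_1_singletonE)
  let ?N = "{v \<in> B k. E v x}"
  \<comment> \<open>A branch set avoiding \<open>X k\<close> lies in \<open>B k\<close>; from there
    \<open>S i\<close> can be reached only at \<open>x\<close>.\<close>
  have "card ({..<t} - {i}) \<le> card ((X k - {x}) \<union> ?N)"
  proof (rule card_le_of_disjoint_hitting[where S = S])
    fix j assume "j \<in> {..<t} - {i}"
    then have j: "j < t" "j \<noteq> i" by auto
    show "S j \<inter> ((X k - {x}) \<union> ?N) \<noteq> {}"
    proof (cases "S j \<inter> X k = {}")
      case True
      then have "S j \<subseteq> B k" using in_piece meet j by blast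
      moreover obtain u v where uv: "u \<in> S j" "v \<in> S i" "E u v" using adj[OF j(1) it j(2)] by blast
      ultimately have "u \<in> B k" "v = x" using nbr[OF k(1), of u v] iB x by blast+
      then show ?thesis using uv by blast
    next
      case False
      then show ?thesis using disj[OF j(1) it j(2)] x by blast
    qed
  qed (use finX B(1)[OF k(1)] disj in auto)
  also have "\<dots> \<le> card (X k - {x}) + card ?N" by (rule card_Un_le)
  also have "card (X k - {x}) = card (X k) - 1" using x by (subst card_Diff_singleton) auto
  finally have "t - 1 \<le> card (X k) - 1 + card ?N" using it by simp
  moreover have "card (X k) > 0" using x finX by (auto simp: card_gt_0_iff)
  moreover have "card ?N + card (X k) < t" using deg[OF k(1)] x by blast
  ultimately show False by linarith
qed

text \<open>The \<open>q\<close> numbers \<open>h * r + i\<close> with \<open>h < q\<close> all lie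
  in the class. This bounds from below the vertices of a piece that miss a given attachment
  vertex.\<close>

lemma card_residue_class_ge:
  fixes r q i b :: nat
  assumes "i < r" "q * r \<le> b"
  shows "q \<le> card {j. j < b \<and> j mod r = i}"
proof -
  have "inj_on (\<lambda>h. h * r + i) {..<q}" using assms by (auto simp: inj_on_def)
  moreover have "h * r + i < b" if "h < q" for h
  proof -
    have "h * r + i < Suc h * r" using assms by simp
    also have "\<dots> \<le> q * r" using that by (intro mult_right_mono) auto
    finally show ?thesis using assms by simp
  qed
  then have "(\<lambda>h. h * r + i) ` {..<q} \<subseteq> {j. j < b \<and> j mod r = i}" using assms by auto
  ultimately have "card {..<q} \<le> card {j. j < b \<and> j mod r = i}"
    by (intro card_inj_on_le) auto
  then show ?thesis by simp
qed

text \<open>By injectivity at most \<open>m\<close> elements take values below \<open>m\<close>,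
  which leaves at least \<open>r\<close> others. A list is produced because the construction refers
  to positions in it.\<close>

lemma obtain_distinct_list_with_large_values:
  fixes f :: "'a \<Rightarrow> nat"
  assumes "finite A" "inj_on f A" "card A = m + r"
  obtains xs where "distinct xs" "length xs = r" "set xs \<subseteq> A" "\<And>x. x \<in> set xs \<Longrightarrow> m \<le> f x"
proof -
  let ?S = "{x \<in> A. f x < m}" and ?T = "{x \<in> A. m \<le> f x}"
  have "card ?S \<le> card {..<m}"
    using assms by (intro card_inj_on_le[of f]) (auto simp: inj_on_def)
  moreover have "card A = card ?S + card ?T"
  proof -
    have "A = ?S \<union> ?T" by auto
    then show ?thesis using assms(1) card_Un_disjoint[of ?S ?T] by fastforce
  qed
  ultimately have "r \<le> card ?T" using assms by simp
  then obtain T where T: "T \<subseteq> ?T" "card T = r" "finite T" by (rule obtain_subset_with_card_n)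
  then obtain xs where "set xs = T" "distinct xs" using finite_distinct_list by blast
  then show ?thesis using T by (intro that[of xs]) (auto simp: distinct_card[symmetric])
qed

theorem theorem2:
  fixes a :: nat
  shows "\<exists>t1::nat. \<forall>t\<ge>t1. \<exists>(V :: nat set) (E :: nat \<Rightarrow> nat \<Rightarrow> bool).
           simple_graph V E \<and> K_minor_free V E t \<and>
           \<not> lambda_choosable V E (replicate (t - 2*a - 6) 1 @ [3*a + 6])"
proof (intro exI[of _ "(a + 3) * (2 * a + 5) + a + 3"] allI impI)
  fix t :: nat assume t: "(a + 3) * (2 * a + 5) + a + 3 \<le> t"
  define r where "r = 2 * a + 5"
  define m where "m = t - 2 * a - 6"
  define n where "n = t - 1"
  define b where "b = t - a - 3"
  define c where "c = m + 3 * a + 7"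
  \<comment> \<open>The threshold on \<open>t\<close> is chosen for this: every residue class mod
    \<open>r\<close> has at least \<open>a + 3\<close> members below \<open>b\<close>.\<close>
  have b_ge: "(a + 3) * r \<le> b" using t by (simp add: b_def r_def)
  have "3 * (2 * a + 5) + (a + 3) \<le> (a + 3) * (2 * a + 5) + (a + 3)"
    by (intro add_right_mono mult_right_mono) auto
  also have "\<dots> \<le> t" using t by (simp only: add.assoc)
  finally have t_ge: "2 * a + 6 \<le> t" by simp
  have n: "n = m + r" "n < t" "0 < n" using t_ge by (auto simp: n_def m_def r_def)
  have r: "0 < r" by (simp add: r_def)
  have too_few: "c < r + b" using t_ge by (simp add: c_def r_def b_def m_def)

  \<comment> \<open>Repeated entries are allowed, so that \<open>P\<close> is a plain finite product
    containing every possible outcome.\<close>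
  define P :: "(nat list \<times> nat list) set" where
    "P = {xs. set xs \<subseteq> {..<n} \<and> length xs = r} \<times> {cs. set cs \<subseteq> {m..<c} \<and> length cs = r}"
  \<comment> \<open>Vertices must be naturals: piece vertices are encoded injectively above the
    clique \<open>{..<n}\<close>, and \<open>L\<close> decodes them again.\<close>
  define w :: "nat list \<times> nat list \<Rightarrow> nat \<Rightarrow> nat" where "w = (\<lambda>p j. n + to_nat (p, j))"
  define B where "B = (\<lambda>p. w p ` {..<b})"
  define V where "V = {..<n} \<union> (\<Union>p\<in>P. B p)"
  define E where "E = (\<lambda>u v. (u < n \<and> v < n \<and> u \<noteq> v)
    \<or> (\<exists>p\<in>P. \<exists>i<b. \<exists>j<b. i \<noteq> j \<and> u = w p i \<and> v = w p j)
    \<or> (\<exists>p\<in>P. \<exists>j<b. u = w p j \<and> v \<in> set (fst p) \<and> v \<noteq> fst p ! (j mod r))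
    \<or> (\<exists>p\<in>P. \<exists>j<b. v = w p j \<and> u \<in> set (fst p) \<and> u \<noteq> fst p ! (j mod r)))"
  define L :: "nat \<Rightarrow> nat set" where "L = (\<lambda>v. if v < n then {..<c} else
    case from_nat (v - n) of (p :: nat list \<times> nat list, j) \<Rightarrow> {..<c} - {snd p ! (j mod r)})"

  have finP: "finite P" unfolding P_def
    by (intro finite_cartesian_product finite_lists_length_eq) auto
  have w_inj [simp]: "w p i = w q j \<longleftrightarrow> p = q \<and> i = j" for p q i j by (auto simp: w_def)
  have w_ge [simp]: "\<not> w p j < n" for p j by (simp add: w_def)
  have L_A [simp]: "L v = {..<c}" if "v < n" for v using that by (simp add: L_def)
  have L_w [simp]: "L (w p j) = {..<c} - {snd p ! (j mod r)}" for p j by (simp add: L_def w_def)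
  have P_lt: "v < n" if "p \<in> P" "v \<in> set (fst p)" for p v using that by (auto simp: P_def)
  have w_notin: "w p j \<notin> set (fst q)" if "q \<in> P" for p q j using P_lt[OF that] w_ge by blast
  have B_nth: "m \<le> snd p ! i" "snd p ! i < c" if "p \<in> P" "i < r" for p i
    using that nth_mem[of i "snd p"] by (force simp: P_def)+
  have card_B: "card (B p) = b" for p by (simp add: B_def card_image inj_on_def)
  have E_wA: "E (w p j) v \<longleftrightarrow> v \<in> set (fst p) \<and> v \<noteq> fst p ! (j mod r)"
    if "p \<in> P" "j < b" "v < n" for p j v
  proof -
    have "v \<noteq> w q i" for q i using that(3) w_ge by blast
    then show ?thesis using that w_notin unfolding E_def by auto
  qed
  have E_sym: "E v u" if "E u v" for u v using that unfolding E_def by blast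

  have simple: "simple_graph V E"
    unfolding simple_graph_def
  proof (intro conjI allI impI)
    show "finite V" using finP by (auto simp: V_def B_def)
    show "E v u" if "E u v" for u v using that by (rule E_sym)
    show "\<not> E v v" for v using w_notin by (auto simp: E_def)
    have E_V: "u \<in> V" if "E u v" for u v
      using that P_lt by (auto simp: E_def V_def B_def)
    show "u \<in> V" "v \<in> V" if "E u v" for u v using that E_V E_sym by blast+
  qed

  have minor_free: "K_minor_free V E t"
  proof (rule K_minor_free_attached_pieces[where A = "{..<n}" and K = P and B = B
        and X = "\<lambda>p. set (fst p)" and a = a])
    show "card (B p) + a + 3 \<le> t" for p using t by (simp add: card_B b_def)
    show "card (set (fst p)) \<le> 2 * a + 5" if "p \<in> P" for p
      using that card_length[of "fst p"] by (auto simp: P_def r_def)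
    show "v \<in> B p \<union> set (fst p)" if "p \<in> P" "u \<in> B p" "E u v" for p u v
      using that w_notin by (cases p) (auto simp: E_def B_def)
    fix p x assume p: "p \<in> P" and x: "x \<in> set (fst p)"
    have len: "length (fst p) = r" using p by (auto simp: P_def)
    obtain i where i: "i < r" "x = fst p ! i" using x len by (auto simp: in_set_conv_nth)
    \<comment> \<open>Even if \<open>x\<close> occurs at several positions, one position
      \<open>i\<close> already excludes \<open>a + 3\<close> neighbours. This just suffices, since
      \<open>b - (a + 3) + r = t - 1\<close>.\<close>
    let ?J = "{j. j < b \<and> j mod r = i}"
    have "{v \<in> B p. E v x} \<subseteq> w p ` ({..<b} - ?J)"
      using i E_wA[OF p _ P_lt[OF p x]] by (auto simp: B_def)
    then have "card {v \<in> B p. E v x} \<le> card ({..<b} - ?J)"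
      by (meson card_image_le card_mono finite_Diff finite_imageI finite_lessThan order_trans)
    also have "\<dots> = b - card ?J" by (subst card_Diff_subset) auto
    also have "\<dots> \<le> b - (a + 3)"
      using card_residue_class_ge[OF i(1) b_ge] by simp
    finally have "card {v \<in> B p. E v x} \<le> b - (a + 3)" .
    moreover have "card (set (fst p)) \<le> r" using card_length[of "fst p"] len by simp
    ultimately show "card {v \<in> B p. E v x} + card (set (fst p)) < t"
      using t_ge by (simp add: b_def r_def)
  qed (use n P_lt in \<open>auto simp: V_def B_def\<close>)

  have lists: "lambda_list_assignment V (replicate m 1 @ [3 * a + 6]) L"
    unfolding lambda_list_assignment_def
  \<comment> \<open>Each common colour is a part of its own, and the \<open>3 * a + 7\<close>
    special colours form the last part, so that losing one leaves \<open>3 * a + 6\<close>.\<close>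
  proof (intro exI[of _ "\<lambda>i. if i < m then {i} else {m..<c}"] conjI allI impI ballI)
    have "m \<le> c" by (simp add: c_def)
    then have "(\<Union>i<Suc m. if i < m then {i} else {m..<c}) = {..<c}"
      by (auto split: if_splits)
    moreover have "(\<Union>v\<in>V. L v) = {..<c}"
    proof
      show "(\<Union>v\<in>V. L v) \<subseteq> {..<c}" by (auto simp: V_def B_def)
      have "L 0 = {..<c}" "0 \<in> V" using n by (auto simp: V_def)
      then show "{..<c} \<subseteq> (\<Union>v\<in>V. L v)" by blast
    qed
    ultimately show "(\<Union>i<length (replicate m 1 @ [3 * a + 6]). if i < m then {i} else {m..<c})
        = (\<Union>v\<in>V. L v)" by simp
  next
    fix i v assume i: "i < length (replicate m 1 @ [3 * a + 6])" and v: "v \<in> V"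
    \<comment> \<open>\<open>y\<close> is the special colour missing from the list; on the clique,
      where none is missing, \<open>m\<close> serves as a dummy.\<close>
    obtain y where y: "m \<le> y" "y < c" "{..<c} - {y} \<subseteq> L v"
    proof (cases "v < n")
      case True
      then show ?thesis by (intro that[of m]) (auto simp: c_def)
    next
      case False
      then obtain p j where p: "p \<in> P" "v = w p j" using v by (auto simp: V_def B_def)
      then show ?thesis using B_nth[OF p(1), of "j mod r"] r
        by (intro that[of "snd p ! (j mod r)"]) auto
    qed
    have fin: "finite (L v)"
      using v by (auto simp: V_def B_def)
    show "(replicate m 1 @ [3 * a + 6]) ! i \<le> card (L v \<inter> (if i < m then {i} else {m..<c}))"
    proof (cases "i < m")
      case True
      then have "L v \<inter> {i} = {i}" using y by auto
      then show ?thesis using True by (simp add: nth_append)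
    next
      case False
      have "card ({m..<c} - {y}) \<le> card (L v \<inter> {m..<c})"
        by (rule card_mono) (use y fin in auto)
      moreover have "card ({m..<c} - {y}) = 3 * a + 6" using y by (simp add: c_def)
      ultimately show ?thesis using False i by (simp add: nth_append)
    qed
  qed auto

  have "\<not> L_colourable V E L"
  proof
    assume "L_colourable V E L"
    then obtain f where f: "\<And>v. v \<in> V \<Longrightarrow> f v \<in> L v"
        "\<And>u v. u \<in> V \<Longrightarrow> v \<in> V \<Longrightarrow> E u v \<Longrightarrow> f u \<noteq> f v"
      unfolding L_colourable_def L_colouring_def by blast
    have A_V: "v \<in> V" if "v < n" for v using that by (simp add: V_def)
    have inj: "inj_on f {..<n}" using f(2) A_V by (auto simp: inj_on_def E_def)
    obtain xs where xs: "distinct xs" "length xs = r" "set xs \<subseteq> {..<n}"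
        and xs_ge: "\<And>x. x \<in> set xs \<Longrightarrow> m \<le> f x"
      using obtain_distinct_list_with_large_values[OF _ inj, of m r] n by auto
    define p where "p = (xs, map f xs)"
    have lt_c: "f v < c" if "v < n" for v using f(1)[OF A_V[OF that]] that by simp
    have p: "p \<in> P" using xs xs_ge lt_c by (auto simp: P_def p_def)
    have w_V: "w p j \<in> V" if "j < b" for j using that p by (auto simp: V_def B_def)
    have f_w: "f (w p j) < c" "f (w p j) \<noteq> f (xs ! (j mod r))" if "j < b" for j
      using f(1)[OF w_V[OF that]] xs r by (auto simp: p_def)
    have injB: "inj_on (\<lambda>j. f (w p j)) {..<b}"
    proof (rule inj_onI, rule ccontr)
      fix i j assume ij: "i \<in> {..<b}" "j \<in> {..<b}" "f (w p i) = f (w p j)" "i \<noteq> j"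
      then have "E (w p i) (w p j)" using p by (auto simp: E_def)
      then show False using f(2)[OF w_V w_V] ij by blast
    qed
    \<comment> \<open>Adjacency separates the colours except when \<open>x\<close> is the one
      skipped vertex; there the list of \<open>w p j\<close> omits the colour of
      \<open>x\<close>.\<close>
    have "f (w p j) \<noteq> f x" if j: "j < b" and x: "x \<in> set xs" for j x
    proof (cases "x = xs ! (j mod r)")
      case False
      have "x < n" using x xs by auto
      with False x have "E (w p j) x" using E_wA[OF p j] by (simp add: p_def)
      then show ?thesis using f(2)[OF w_V[OF j] A_V[OF \<open>x < n\<close>]] by blast
    qed (use f_w j in blast)
    then have "card (f ` set xs \<union> (\<lambda>j. f (w p j)) ` {..<b})
        = card (f ` set xs) + card ((\<lambda>j. f (w p j)) ` {..<b})"
      by (intro card_Un_disjoint) fastforce+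
    also have "\<dots> = r + b"
      using xs inj injB by (simp add: card_image inj_on_subset distinct_card)
    finally have "r + b = card (f ` set xs \<union> (\<lambda>j. f (w p j)) ` {..<b})" by simp
    also have "\<dots> \<le> card {..<c}" by (rule card_mono) (use xs lt_c f_w in auto)
    finally show False using too_few by simp
  qed
  then have "\<not> lambda_choosable V E (replicate (t - 2*a - 6) 1 @ [3*a + 6])"
    using lists unfolding lambda_choosable_def m_def by blast
  with simple minor_free show "\<exists>(V :: nat set) (E :: nat \<Rightarrow> nat \<Rightarrow> bool).
      simple_graph V E \<and> K_minor_free V E t \<and>
      \<not> lambda_choosable V E (replicate (t - 2*a - 6) 1 @ [3*a + 6])" by blast
qed

end
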